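(* Let $3 \le p \le q$ and let $D$ be a strong orientation of $K(3,p,q)$ with parts $V_1=\{x_1,x_2,x_3\}$, $V_2$ ($|V_2|=p$), $V_3$ ($|V_3|=q$). If exactly one of the eight sets $V_2^A$ ($A \subseteq \{1,2,3\}$) is nonempty, then $\mathrm{diam}(D) \ge 3$.
   Context: $K(3,p,q)$ is the complete tripartite graph with parts $V_1=\{x_1,x_2,x_3\}$, $V_2$ of size $p$, $V_3$ of size $q$. A strong orientation is an orientation of all edges making the digraph strongly connected; $\mathrm{diam}(D)$ is the maximum directed distance between ordered pairs of vertices. Write $u\to v$ if the edge $uv$ is oriented from $u$ to $v$. For $A \subseteq [3]=\{1,2,3\}$, let $N_D^A$ be the set of vertices $w$ such that $x_i \to w$ for all $i \in A$ and $w \to x_j$ for all $j \in [3]\setminus A$ (so $N_D^{[3]}$ is the set of common out-neighbours of $x_1,x_2,x_3$ and $N_D^{\emptyset}$ the set of common in-neighbours), and $V_2^A = V_2 \cap N_D^A$. The eight sets $V_2^A$ partition $V_2$. *)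

theory Defs
  imports "Graph_Theory.Graph_Theory"
begin

text \<open>As in \<^theory>\<open>Graph_Theory.Kuratowski\<close>, an undirected graph is represented by a
  symmetric digraph: each edge appears as two opposite arcs.\<close>

definition complete_tripartite :: "'a set \<Rightarrow> 'a set \<Rightarrow> 'a set \<Rightarrow> 'a pair_pre_digraph" where
  "complete_tripartite V1 V2 V3 =
     \<lparr> pverts = V1 \<union> V2 \<union> V3,
       parcs = V1 \<times> V2 \<union> V2 \<times> V1 \<union> V1 \<times> V3 \<union> V3 \<times> V1 \<union> V2 \<times> V3 \<union> V3 \<times> V2 \<rparr>"

definition orientation :: "('a, 'b) pre_digraph \<Rightarrow> ('a, 'c) pre_digraph \<Rightarrow> bool" where
  "orientation D G \<longleftrightarrow> digraph D \<and> graph G \<and> verts D = verts G \<and>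
     (\<forall>u v. u \<rightarrow>\<^bsub>G\<^esub> v \<longleftrightarrow> u \<rightarrow>\<^bsub>D\<^esub> v \<or> v \<rightarrow>\<^bsub>D\<^esub> u) \<and>
     (\<forall>u v. \<not> (u \<rightarrow>\<^bsub>D\<^esub> v \<and> v \<rightarrow>\<^bsub>D\<^esub> u))"

text \<open>With all arc weights 1, \<open>\<mu>\<close> is the least length of a directed walk, and \<open>\<infinity>\<close> if there
  is none. For a finite nonempty digraph the supremum is a maximum.\<close>

definition directed_dist :: "('a, 'b) pre_digraph \<Rightarrow> 'a \<Rightarrow> 'a \<Rightarrow> ereal" where
  "directed_dist D u v = wf_digraph.\<mu> D (\<lambda>_. 1) u v"

definition diam :: "('a, 'b) pre_digraph \<Rightarrow> ereal" where
  "diam D = (SUP u\<in>verts D. SUP v\<in>verts D. directed_dist D u v)"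

text \<open>\<open>nbr_class D x A\<close> is \<open>N\<^sub>D\<^sup>A\<close> for the vertices \<open>x 1, x 2, x 3\<close>; only the values of \<open>x\<close>
  on \<open>{1, 2, 3}\<close> matter.\<close>

definition nbr_class :: "('a, 'b) pre_digraph \<Rightarrow> (nat \<Rightarrow> 'a) \<Rightarrow> nat set \<Rightarrow> 'a set" where
  "nbr_class D x A =
     {w \<in> verts D. (\<forall>i\<in>A. x i \<rightarrow>\<^bsub>D\<^esub> w) \<and> (\<forall>j\<in>{1, 2, 3} - A. w \<rightarrow>\<^bsub>D\<^esub> x j)}"

end

theory Submission
  imports Defs
begin

text \<open>If the diameter is at most 2, any two vertices are joined by a directed walk of length at
  most 2. Two of \<open>x\<^sub>1, x\<^sub>2, x\<^sub>3\<close>, say \<open>a\<close> and \<open>b\<close>, lie on the same side of the single class: either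
  both dominate \<open>V\<^sub>2\<close> or both are dominated by it. In the latter case \<open>a\<close> and \<open>b\<close> can leave only
  to \<open>V\<^sub>3\<close>, so a vertex of \<open>V\<^sub>3\<close> is within distance 2 of them only if it is an out-neighbour; hence
  both dominate all of \<open>V\<^sub>3\<close>, and there is no walk of length 2 from \<open>a\<close> to \<open>b\<close>. The other case is
  the same argument in the converse digraph.\<close>

text \<open>The distance is an infimum over walks, so a value strictly below 3 is witnessed by one
  walk of cost below 3. With unit weights the cost counts the arcs, which leaves zero, one or two of
  them.\<close>

lemma directed_dist_less_3D:
  assumes "wf_digraph D" and "directed_dist D u v < 3"
  shows "u = v \<or> u \<rightarrow>\<^bsub>D\<^esub> v \<or> (\<exists>w. u \<rightarrow>\<^bsub>D\<^esub> w \<and> w \<rightarrow>\<^bsub>D\<^esub> v)"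
proof -
  interpret wf_digraph D by fact
  from assms(2) obtain es where es: "awalk u es v" "ereal (awalk_cost (\<lambda>_. 1) es) < 3"
    by (auto simp: directed_dist_def \<mu>_def INF_less_iff)
  have "awalk_cost (\<lambda>_. 1) es = real (length es)"
    by (induction es) (auto simp: awalk_cost_def)
  with es(2) have "length es < 3"
    by simp
  then consider "es = []" | e where "es = [e]" | e f where "es = [e, f]"
    by (cases es; cases "tl es"; cases "tl (tl es)") auto
  then show ?thesis
  proof cases
    case 1
    with es(1) show ?thesis by (simp add: awalk_Nil_iff)
  next
    case 2
    with es(1) have "u \<rightarrow>\<^bsub>D\<^esub> v"
      using in_arcs_imp_in_arcs_ends[of e] by (simp add: awalk_Cons_iff awalk_Nil_iff)
    then show ?thesis by blast
  next
    case 3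
    with es(1) have "u \<rightarrow>\<^bsub>D\<^esub> head D e" "head D e \<rightarrow>\<^bsub>D\<^esub> v"
      using in_arcs_imp_in_arcs_ends[of e] in_arcs_imp_in_arcs_ends[of f]
      by (simp_all add: awalk_Cons_iff awalk_Nil_iff)
    then show ?thesis by blast
  qed
qed

lemma diam_less_3D:
  assumes "wf_digraph D" and "diam D < 3" and "u \<in> verts D" and "v \<in> verts D" and "u \<noteq> v"
  shows "u \<rightarrow>\<^bsub>D\<^esub> v \<or> (\<exists>w. u \<rightarrow>\<^bsub>D\<^esub> w \<and> w \<rightarrow>\<^bsub>D\<^esub> v)"
proof -
  have "directed_dist D u v \<le> diam D"
    unfolding diam_def using assms(3,4) by (meson SUP_upper2 order_refl)
  with assms(2) have "directed_dist D u v < 3" by simp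
  from directed_dist_less_3D[OF assms(1) this] \<open>u \<noteq> v\<close> show ?thesis by blast
qed

text \<open>Stated for a relation rather than a digraph so that it also applies to the converse.\<close>

lemma no_two_common_out_neighbours:
  assumes edge: "\<And>u v. R u v \<Longrightarrow>
      (u, v) \<in> V1 \<times> V2 \<union> V2 \<times> V1 \<union> V1 \<times> V3 \<union> V3 \<times> V1 \<union> V2 \<times> V3 \<union> V3 \<times> V2"
    and disj: "V1 \<inter> V2 = {}" "V1 \<inter> V3 = {}" "V2 \<inter> V3 = {}"
    and asym: "\<And>u v. R u v \<Longrightarrow> \<not> R v u"
    and two_step: "\<And>u v. u \<in> V1 \<Longrightarrow> v \<in> V1 \<union> V3 \<Longrightarrow> u \<noteq> v \<Longrightarrow> R u v \<or> (\<exists>w. R u w \<and> R w v)"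
    and ab: "a \<in> V1" "b \<in> V1" "a \<noteq> b"
    and dom: "\<And>w. w \<in> V2 \<Longrightarrow> R w a \<and> R w b"
  shows False
proof -
  have out: "R c w" if "c = a \<or> c = b" and "w \<in> V3" for c w
  proof -
    have "c \<in> V1" "c \<noteq> w" using that ab disj by auto
    then consider "R c w" | z where "R c z" "R z w"
      using two_step[of c w] \<open>w \<in> V3\<close> by blast
    then show ?thesis
    proof cases
      case 2
      \<comment> \<open>A vertex adjacent to both \<open>V1\<close> and \<open>V3\<close> lies in
        \<open>V2\<close>. But \<open>V2\<close> dominates \<open>c\<close>, so asymmetry excludes
        the arc from \<open>c\<close> to \<open>z\<close>.\<close>
      with edge[of c z] edge[of z w] \<open>c \<in> V1\<close> \<open>w \<in> V3\<close> disj have "z \<in> V2" by blast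
      with dom asym \<open>R c z\<close> that(1) show ?thesis by blast
    qed
  qed
  have "\<not> R a b" using edge[of a b] ab disj by blast
  with two_step[of a b] ab obtain z where z: "R a z" "R z b" by blast
  with edge[of a z] ab disj have "z \<in> V2 \<union> V3" by blast
  \<comment> \<open>For \<open>z\<close> in \<open>V2\<close>, \<open>dom\<close> reverses the arc
    from \<open>a\<close> to \<open>z\<close>; for \<open>z\<close> in \<open>V3\<close>,
    \<open>out\<close> reverses the arc from \<open>z\<close> to \<open>b\<close>.\<close>
  with z dom out asym show False by blast
qed

theorem theorem4p3:
  fixes D :: "('a, 'b) pre_digraph"
    and V1 V2 V3 :: "'a set" and x :: "nat \<Rightarrow> 'a" and p q :: nat
  assumes "3 \<le> p" and "p \<le> q"
    and "bij_betw x {1, 2, 3} V1" and "card V2 = p" and "card V3 = q"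
    and "V1 \<inter> V2 = {}" and "V1 \<inter> V3 = {}" and "V2 \<inter> V3 = {}"
    and "orientation D (with_proj (complete_tripartite V1 V2 V3))"
    and "strongly_connected D"
    and "\<exists>!A. A \<subseteq> {1, 2, 3} \<and> V2 \<inter> nbr_class D x A \<noteq> {}"
  shows "diam D \<ge> 3"
proof (rule ccontr)
  assume "\<not> diam D \<ge> 3"
  then have diam: "diam D < 3" by simp
  let ?G = "with_proj (complete_tripartite V1 V2 V3)"
  let ?E = "V1 \<times> V2 \<union> V2 \<times> V1 \<union> V1 \<times> V3 \<union> V3 \<times> V1 \<union> V2 \<times> V3 \<union> V3 \<times> V2"
  have "digraph D" and V: "verts D = verts ?G"
    and adj: "\<And>u v. u \<rightarrow>\<^bsub>?G\<^esub> v \<longleftrightarrow> u \<rightarrow>\<^bsub>D\<^esub> v \<or> v \<rightarrow>\<^bsub>D\<^esub> u"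
    and asym: "\<And>u v. u \<rightarrow>\<^bsub>D\<^esub> v \<Longrightarrow> \<not> v \<rightarrow>\<^bsub>D\<^esub> u"
    using assms(9) unfolding orientation_def by blast+
  \<comment> \<open>Used in both directions: vertices of different parts are joined by an arc one
    way or the other, and no arc stays inside a part.\<close>
  have arcs: "(u, v) \<in> ?E \<longleftrightarrow> u \<rightarrow>\<^bsub>D\<^esub> v \<or> v \<rightarrow>\<^bsub>D\<^esub> u" for u v
    using adj[of u v] unfolding with_proj_simps complete_tripartite_def pair_pre_digraph.simps .
  have verts: "verts D = V1 \<union> V2 \<union> V3"
    using V by (simp add: complete_tripartite_def)
  have "wf_digraph D"
    using \<open>digraph D\<close> by (simp add: digraph_def fin_digraph_def)
  note two_step = diam_less_3D[OF this diam]
  have V1: "x i \<in> V1" if "i \<in> {1, 2, 3}" for i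
    using that assms(3) by (auto simp: bij_betw_def)
  from assms(11) obtain A
    where uniq: "\<forall>B. B \<subseteq> {1, 2, 3} \<and> V2 \<inter> nbr_class D x B \<noteq> {} \<longrightarrow> B = A"
    by (elim ex1E) (rule that)
  have cls: "if i \<in> A then x i \<rightarrow>\<^bsub>D\<^esub> w else w \<rightarrow>\<^bsub>D\<^esub> x i" if "w \<in> V2" "i \<in> {1, 2, 3}" for w i
  proof -
    \<comment> \<open>The index set read off from \<open>w\<close>. As \<open>w\<close> is adjacent
      to every \<open>x j\<close>, it lies in the class of \<open>?B\<close>, and uniqueness forces
      the same \<open>A\<close> for every \<open>w\<close> in \<open>V2\<close>.\<close>
    let ?B = "{i \<in> {1, 2, 3}. x i \<rightarrow>\<^bsub>D\<^esub> w}"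
    have total: "x j \<rightarrow>\<^bsub>D\<^esub> w \<or> w \<rightarrow>\<^bsub>D\<^esub> x j" if "j \<in> {1, 2, 3}" for j
      using arcs[of "x j" w] V1[OF that] \<open>w \<in> V2\<close> by blast
    then have "w \<in> nbr_class D x ?B"
      using \<open>w \<in> V2\<close> by (auto simp: nbr_class_def verts)
    with \<open>w \<in> V2\<close> have "?B = A" by (intro uniq[rule_format]) auto
    with total[OF that(2)] that(2) show ?thesis by auto
  qed
  \<comment> \<open>Pigeonhole: three indices, each inside or outside \<open>A\<close>.\<close>
  have "\<exists>i\<in>{1, 2, 3}. \<exists>j\<in>{1, 2, 3}. i \<noteq> j \<and> (i \<in> A \<longleftrightarrow> j \<in> A)"
    by (cases "1 \<in> A"; cases "2 \<in> A"; cases "3 \<in> A") simp_all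
  then obtain i j where ij: "i \<in> {1, 2, 3}" "j \<in> {1, 2, 3}" "i \<noteq> j" "i \<in> A \<longleftrightarrow> j \<in> A"
    by blast
  have neq: "x i \<noteq> x j"
    using ij assms(3) by (metis bij_betw_def inj_on_eq_iff)
  show False
  proof (cases "i \<in> A")
    case False
    show False
    proof (rule no_two_common_out_neighbours
        [of "\<lambda>u v. u \<rightarrow>\<^bsub>D\<^esub> v", OF _ assms(6-8) _ _ V1[OF ij(1)] V1[OF ij(2)] neq])
      show "(u, v) \<in> ?E" if "u \<rightarrow>\<^bsub>D\<^esub> v" for u v
        using arcs that by blast
      show "\<not> v \<rightarrow>\<^bsub>D\<^esub> u" if "u \<rightarrow>\<^bsub>D\<^esub> v" for u v
        using asym that .
      show "u \<rightarrow>\<^bsub>D\<^esub> v \<or> (\<exists>w. u \<rightarrow>\<^bsub>D\<^esub> w \<and> w \<rightarrow>\<^bsub>D\<^esub> v)"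
        if "u \<in> V1" "v \<in> V1 \<union> V3" "u \<noteq> v" for u v
        using that by (intro two_step) (auto simp: verts)
      show "w \<rightarrow>\<^bsub>D\<^esub> x i \<and> w \<rightarrow>\<^bsub>D\<^esub> x j" if "w \<in> V2" for w
        using cls[OF that ij(1)] cls[OF that ij(2)] False ij(4) by simp
    qed
  next
    case True
    show False
    proof (rule no_two_common_out_neighbours
        [of "\<lambda>u v. v \<rightarrow>\<^bsub>D\<^esub> u", OF _ assms(6-8) _ _ V1[OF ij(1)] V1[OF ij(2)] neq])
      show "(u, v) \<in> ?E" if "v \<rightarrow>\<^bsub>D\<^esub> u" for u v
        using arcs that by blast
      show "\<not> u \<rightarrow>\<^bsub>D\<^esub> v" if "v \<rightarrow>\<^bsub>D\<^esub> u" for u v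
        using asym that .
      \<comment> \<open>A walk from \<open>u\<close> to \<open>v\<close> in the converse is a walk
        from \<open>v\<close> to \<open>u\<close> in \<open>D\<close>, so \<open>two_step\<close> is
        applied with the endpoints exchanged.\<close>
      show "v \<rightarrow>\<^bsub>D\<^esub> u \<or> (\<exists>w. w \<rightarrow>\<^bsub>D\<^esub> u \<and> v \<rightarrow>\<^bsub>D\<^esub> w)"
        if "u \<in> V1" "v \<in> V1 \<union> V3" "u \<noteq> v" for u v
        using that two_step[of v u] by (auto simp: verts)
      show "x i \<rightarrow>\<^bsub>D\<^esub> w \<and> x j \<rightarrow>\<^bsub>D\<^esub> w" if "w \<in> V2" for w
        using cls[OF that ij(1)] cls[OF that ij(2)] True ij(4) by simp
    qed
  qed
qed

end
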